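(* Let $n,m\geq 1$ be integers and let $\phi:\mathbb{R}^m\times\mathbb{R}^n\to\mathbb{R}$, $(t,x)\mapsto\phi(t,x)$, be a convex function (jointly in $(t,x)$). For $(t,x)\in\mathbb{R}^m\times\mathbb{R}^n$ define $$\hat\phi(t,x) = E\big(\phi(t,\cdot)\big)(x)=\sup\Big\{\psi(x)\;:\;\psi:\mathbb{R}^n\to\mathbb{R}\ \text{convex},\ \int_{\mathbb{R}^n}e^{\psi(y)-\phi(t,y)}\,dy\leq 1\Big\}.$$ Then $\hat\phi$ is a convex function on $\mathbb{R}^m\times\mathbb{R}^n$ (jointly in $(t,x)$).
   Context: For a convex function $\varphi:\mathbb{R}^n\to\mathbb{R}$, the extremal function $E(\varphi)$ is defined by $$E(\varphi)(x):=\sup\Big\{\psi(x)\;:\;\psi:\mathbb{R}^n\to\mathbb{R}\ \text{convex},\ \int_{\mathbb{R}^n}e^{\psi(y)-\varphi(y)}\,dy\leq 1\Big\},\qquad x\in\mathbb{R}^n.$$ In the definition of $\hat\phi$, $E$ is taken with respect to the $x$-variable for each fixed $t$. Integrals are with respect to Lebesgue measure on $\mathbb{R}^n$. The supremum of the empty set is $-\infty$, and convexity of a function with values in $[-\infty,+\infty]$ means that its epigraph $\{(t,x,s)\in\mathbb{R}^m\times\mathbb{R}^n\times\mathbb{R}: s\geq\hat\phi(t,x)\}$ is a convex set. *)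

theory Defs
  imports "HOL-Analysis.Analysis"
begin

text \<open>The supremum is taken in \<^typ>\<open>ereal\<close>, where the empty supremum is \<open>-\<infinity>\<close>.
  A finite convex function on the whole space is continuous, so the integrand is a nonnegative
  Borel function; its integral is a value in \<open>[0, \<infinity>]\<close>, so a divergent integral does not
  satisfy the constraint.\<close>

definition extremal_function :: "('a::euclidean_space \<Rightarrow> real) \<Rightarrow> 'a \<Rightarrow> ereal" where
  "extremal_function \<phi> x =
     Sup {ereal (\<psi> x) | \<psi>. convex_on UNIV \<psi> \<and>
            (\<integral>\<^sup>+ y. ennreal (exp (\<psi> y - \<phi> y)) \<partial>lborel) \<le> 1}"

text \<open>The library's \<^const>\<open>epigraph\<close> and \<^const>\<open>convex_on\<close> require real values; for extended
  real values only the finite heights \<open>s\<close> enter the epigraph.\<close>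

definition convex_ereal_fun :: "('a::real_vector \<Rightarrow> ereal) \<Rightarrow> bool" where
  "convex_ereal_fun f \<longleftrightarrow> convex {(z, s::real). f z \<le> ereal s}"

end

theory Submission
  imports Defs
begin

text \<open>A convex \<open>\<psi>\<close> has an affine minorant that agrees with it at a given point, so only affine
  competitors matter and \<open>E(\<phi>(t, _))(x) = sup\<^sub>\<xi> (\<xi> \<bullet> x - log \<integral> exp (\<xi> \<bullet> y - \<phi>(t, y)) dy)\<close>.
  By Prekopa's theorem the logarithm is concave in \<open>t\<close>, hence the right-hand side is a supremum of
  jointly convex functions. The Prekopa--Leindler inequality is proved in dimension one from the
  Brunn--Minkowski inequality for superlevel sets, and in general by integrating out one coordinate
  at a time.\<close>

section \<open>The Brunn-Minkowski inequality on the real line\<close>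

lemma emeasure_lborel_affine_vimage:
  fixes c :: real
  assumes "A \<in> sets borel" "c > 0"
  shows "emeasure lborel ((\<lambda>z. (z - t) / c) -` A) = ennreal c * emeasure lborel A"
proof -
  let ?B = "(\<lambda>z. (z - t) / c) -` A"
  have B: "?B \<in> sets borel"
    using assms measurable_sets[of "\<lambda>z. (z - t) / c" borel borel A] by simp
  have "emeasure lborel ?B = (\<integral>\<^sup>+z. indicator ?B z \<partial>lborel)"
    using B by simp
  also have "\<dots> = ennreal \<bar>c\<bar> * (\<integral>\<^sup>+x. indicator ?B (t + c * x) \<partial>lborel)"
    by (rule nn_integral_real_affine) (use B assms in auto)
  also have "(\<lambda>x. indicator ?B (t + c * x) :: ennreal) = indicator A"
    using assms by (auto simp: indicator_def fun_eq_iff)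
  finally show ?thesis using assms by simp
qed

text \<open>Passes from truncated sets to all of \<open>A\<close>. If \<open>r\<close> attains a
  maximum on \<open>A\<close>, truncation there changes nothing. Otherwise countably many
  truncations increase to \<open>A\<close>, and the measure is continuous from below.\<close>

lemma emeasure_add_le_by_sublevels:
  fixes r :: "real \<Rightarrow> real" and C K :: ennreal
  assumes A: "A \<in> sets borel" "A \<noteq> {}" and r: "continuous_on UNIV r"
    and le: "\<And>p. p \<in> A \<Longrightarrow> a * emeasure lborel (A \<inter> {x. r x \<le> r p}) + K \<le> C"
  shows "a * emeasure lborel A + K \<le> C"
proof (cases "\<exists>p\<in>A. \<forall>x\<in>A. r x \<le> r p")
  case True
  then obtain p where p: "p \<in> A" "\<forall>x\<in>A. r x \<le> r p" by blast
  then have "A \<inter> {x. r x \<le> r p} = A" by auto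
  with le[OF p(1)] show ?thesis by simp
next
  case False
  obtain D where D: "countable D" "D \<subseteq> A" "A \<subseteq> closure D"
    using separable by metis
  have "D \<noteq> {}" using D A by auto
  with D(1) obtain d :: "nat \<Rightarrow> real" where d: "range d = D"
    by (metis uncountable_def)
  \<comment> \<open>Running maxima of \<open>r\<close> along a dense sequence in \<open>A\<close>:
    they increase, and each is attained at a point of \<open>A\<close>, so \<open>le\<close> applies
    at every stage.\<close>
  define m where "m n = Max ((r \<circ> d) ` {..n})" for n
  have m_in: "\<exists>p\<in>A. m n = r p" for n
  proof -
    have "m n \<in> (r \<circ> d) ` {..n}" unfolding m_def by (rule Max_in) auto
    then show ?thesis using d D by auto
  qed
  have m_mono: "incseq m"
    unfolding m_def by (intro incseq_SucI Max_mono) auto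
  have rm: "{x. r x \<le> c} \<in> sets borel" for c
    using r by (intro borel_closed closed_Collect_le) auto
  \<comment> \<open>As \<open>r\<close> has no maximum on \<open>A\<close>, some \<open>y\<close> in
    \<open>A\<close> has \<open>r x < r y\<close>; by continuity a point of the dense sequence also
    exceeds \<open>r x\<close>.\<close>
  have cover: "(\<Union>n. A \<inter> {x. r x \<le> m n}) = A"
  proof (safe, clarsimp)
    fix x assume x: "x \<in> A"
    with False obtain y where y: "y \<in> A" "r x < r y" by (meson not_le)
    have "open {z. r x < r z}"
      using r by (intro open_Collect_less) auto
    moreover have "y \<in> closure D" using y D by auto
    ultimately obtain z where "z \<in> D" "r x < r z"
      using y open_Int_closure_eq_empty[of "{z. r x < r z}" D] by blast
    then obtain n where n: "r x < r (d n)" using d by blast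
    have "r (d n) \<le> m n" unfolding m_def by (rule Max_ge) auto
    then show "\<exists>n. r x \<le> m n" using n by (intro exI[of _ n]) auto
  qed
  have "incseq (\<lambda>n. A \<inter> {x. r x \<le> m n})"
    using m_mono by (fastforce simp: incseq_def intro: order_trans)
  then have "emeasure lborel A = (SUP n. emeasure lborel (A \<inter> {x. r x \<le> m n}))"
    using SUP_emeasure_incseq[of "\<lambda>n. A \<inter> {x. r x \<le> m n}" lborel] cover A rm
    by (simp add: image_subset_iff)
  then have "a * emeasure lborel A + K = (SUP n. a * emeasure lborel (A \<inter> {x. r x \<le> m n}) + K)"
    by (simp add: SUP_mult_left_ennreal ennreal_SUP_add_left)
  also have "\<dots> \<le> C"
  proof (rule SUP_least)
    fix n
    obtain p where "p \<in> A" "m n = r p" using m_in by blast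
    then show "a * emeasure lborel (A \<inter> {x. r x \<le> m n}) + K \<le> C" using le by simp
  qed
  finally show ?thesis .
qed

text \<open>The sumset \<open>a A + b B\<close> of Borel sets need not be Borel, so an arbitrary
  Borel set \<open>C\<close> containing it takes its place.\<close>

lemma brunn_minkowski_real:
  fixes a b :: real
  assumes ab: "a > 0" "b > 0"
    and A: "A \<in> sets borel" "A \<noteq> {}" and B: "B \<in> sets borel" "B \<noteq> {}"
    and C: "C \<in> sets borel"
    and sub: "\<And>x y. x \<in> A \<Longrightarrow> y \<in> B \<Longrightarrow> a * x + b * y \<in> C"
  shows "ennreal a * emeasure lborel A + ennreal b * emeasure lborel B \<le> emeasure lborel C"
proof -
  \<comment> \<open>The set \<open>a A + b B\<close> contains translates of the part of \<open>a A\<close> left of \<open>a p\<close> and of the part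
    of \<open>b B\<close> right of \<open>b q\<close> that meet in at most one point.\<close>
  have *: "ennreal a * emeasure lborel (A \<inter> {..p}) + ennreal b * emeasure lborel (B \<inter> {q..})
      \<le> emeasure lborel C" if p: "p \<in> A" and q: "q \<in> B" for p q
  proof -
    define A' where "A' = (\<lambda>z. (z - b * q) / a) -` (A \<inter> {..p})"
    define B' where "B' = (\<lambda>z. (z - a * p) / b) -` (B \<inter> {q..})"
    have m: "A' \<in> sets borel" "B' \<in> sets borel"
      using measurable_sets[of "\<lambda>z. (z - b * q) / a" borel borel "A \<inter> {..p}"]
        measurable_sets[of "\<lambda>z. (z - a * p) / b" borel borel "B \<inter> {q..}"] A B ab
      by (auto simp: A'_def B'_def)
    have "A' \<inter> B' \<subseteq> {a * p + b * q}"
      using ab by (auto simp: A'_def B'_def field_simps)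
    then have "emeasure lborel (A' \<inter> B') \<le> emeasure lborel {a * p + b * q}"
      by (rule emeasure_mono) auto
    then have 0: "emeasure lborel (A' \<inter> B') = 0" by simp
    have "A' \<subseteq> C"
    proof
      fix z assume "z \<in> A'"
      then have "a * ((z - b * q) / a) + b * q \<in> C"
        using q by (intro sub) (auto simp: A'_def)
      then show "z \<in> C" using ab by simp
    qed
    moreover have "B' \<subseteq> C"
    proof
      fix z assume "z \<in> B'"
      then have "a * p + b * ((z - a * p) / b) \<in> C"
        using p by (intro sub) (auto simp: B'_def)
      then show "z \<in> C" using ab by simp
    qed
    ultimately have "emeasure lborel (A' \<union> B') \<le> emeasure lborel C"
      using C by (intro emeasure_mono) auto
    moreover have "emeasure lborel A' + emeasure lborel B' = emeasure lborel (A' \<union> B')"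
      using emeasure_Un_Int[of A' lborel B'] m 0 by simp
    ultimately show ?thesis
      using emeasure_lborel_affine_vimage[of "A \<inter> {..p}" a "b * q"]
        emeasure_lborel_affine_vimage[of "B \<inter> {q..}" b "a * p"] A B ab
      by (simp add: A'_def B'_def)
  qed
  \<comment> \<open>The truncations are removed one at a time: \<open>{..p}\<close> is a sublevel
    set of the identity, and \<open>{q..}\<close> is one of \<open>uminus\<close>.\<close>
  have "ennreal a * emeasure lborel A + ennreal b * emeasure lborel (B \<inter> {q..})
      \<le> emeasure lborel C" if q: "q \<in> B" for q
    using *[OF _ q] by (intro emeasure_add_le_by_sublevels[OF A, of "\<lambda>x. x"]) (auto simp: atMost_def)
  then have "ennreal b * emeasure lborel B + ennreal a * emeasure lborel A \<le> emeasure lborel C"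
    by (intro emeasure_add_le_by_sublevels[OF B, of uminus])
       (auto simp: atLeast_def add.commute intro!: continuous_intros)
  then show ?thesis by (simp add: add.commute)
qed

section \<open>The Prekopa-Leindler inequality on the real line\<close>

text \<open>By Tonelli the order of integration can be exchanged, and for fixed \<open>x\<close> the
  admissible levels \<open>s\<close> form the interval from 0 to \<open>min (f x) 1\<close>. Levels
  stop at 1 because superlevel sets of functions with supremum 1 are nonempty only below it.\<close>

lemma layer_cake_min_1:
  fixes f :: "real \<Rightarrow> ennreal"
  assumes [measurable]: "f \<in> borel_measurable borel"
  shows "(\<integral>\<^sup>+s. emeasure lborel {x. ennreal s < f x} * indicator {0..<1} s \<partial>lborel)
    = (\<integral>\<^sup>+x. min (f x) 1 \<partial>lborel)"
proof -
  let ?k = "\<lambda>s x. indicator {x. ennreal s < f x} x * indicator {0..<1} s :: ennreal"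
  have "emeasure lborel {x. ennreal s < f x} * indicator {0..<1} s = (\<integral>\<^sup>+x. ?k s x \<partial>lborel)" for s
    by (subst nn_integral_multc) auto
  then have "(\<integral>\<^sup>+s. emeasure lborel {x. ennreal s < f x} * indicator {0..<1} s \<partial>lborel)
      = (\<integral>\<^sup>+s. (\<integral>\<^sup>+x. ?k s x \<partial>lborel) \<partial>lborel)" by simp
  also have "\<dots> = (\<integral>\<^sup>+x. (\<integral>\<^sup>+s. ?k s x \<partial>lborel) \<partial>lborel)"
    by (rule lborel_pair.Fubini'[symmetric]) (simp add: indicator_def, measurable)
  also have "\<dots> = (\<integral>\<^sup>+x. min (f x) 1 \<partial>lborel)"
  proof (rule nn_integral_cong)
    fix x
    define r where "r = enn2real (min (f x) 1)"
    have "min (f x) 1 < top" by (simp add: min_less_iff_disj)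
    then have r: "min (f x) 1 = ennreal r" "0 \<le> r" by (simp_all add: r_def)
    have "?k s x = indicator {0..<r} s" for s
    proof (cases "0 \<le> s \<and> s < 1")
      case True
      then have "ennreal s < f x \<longleftrightarrow> ennreal s < min (f x) 1"
        by (simp add: ennreal_less_one_iff)
      also have "\<dots> \<longleftrightarrow> s < r" using r True by (simp add: ennreal_less_iff)
      finally show ?thesis using True by (auto simp: indicator_def)
    next
      case False
      moreover have "r \<le> 1" using r by (metis ennreal_le_1 min.cobounded2)
      ultimately show ?thesis by (auto simp: indicator_def)
    qed
    then show "(\<integral>\<^sup>+s. ?k s x \<partial>lborel) = min (f x) 1"
      using r by simp
  qed
  finally show ?thesis .
qed

text \<open>With both suprema equal to 1, the superlevel sets of \<open>f\<close> and
  \<open>g\<close> are nonempty for the same levels, namely \<open>s < 1\<close>. Brunn-Minkowski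
  applies at each of these, and integration over \<open>s\<close> gives a bound by the weighted
  arithmetic mean.\<close>

lemma prekopa_leindler_normalized:
  fixes f g h :: "real \<Rightarrow> ennreal"
  assumes ab: "a > 0" "b > 0"
    and [measurable]: "f \<in> borel_measurable borel" "g \<in> borel_measurable borel"
      "h \<in> borel_measurable borel"
    and f: "(SUP x. f x) = 1" and g: "(SUP x. g x) = 1"
    and h: "\<And>s x y. 0 \<le> s \<Longrightarrow> ennreal s < f x \<Longrightarrow> ennreal s < g y \<Longrightarrow> ennreal s < h (a * x + b * y)"
  shows "ennreal a * (\<integral>\<^sup>+x. f x \<partial>lborel) + ennreal b * (\<integral>\<^sup>+x. g x \<partial>lborel) \<le> (\<integral>\<^sup>+x. h x \<partial>lborel)"
proof -
  let ?L = "\<lambda>f s. emeasure lborel {x. ennreal s < f x} * indicator {0..<1} s"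
  have min1: "min (f x) 1 = f x" "min (g x) 1 = g x" for x
    using f g by (metis SUP_upper UNIV_I min.absorb1)+
  have meas: "?L f \<in> borel_measurable lborel" if [measurable]: "f \<in> borel_measurable borel" for f
    by measurable
  have "ennreal a * (\<integral>\<^sup>+x. f x \<partial>lborel) + ennreal b * (\<integral>\<^sup>+x. g x \<partial>lborel)
      = ennreal a * (\<integral>\<^sup>+s. ?L f s \<partial>lborel) + ennreal b * (\<integral>\<^sup>+s. ?L g s \<partial>lborel)"
    by (simp add: layer_cake_min_1 min1)
  also have "\<dots> = (\<integral>\<^sup>+s. ennreal a * ?L f s + ennreal b * ?L g s \<partial>lborel)"
    using meas[of f] meas[of g] by (simp add: nn_integral_add nn_integral_cmult)
  also have "\<dots> \<le> (\<integral>\<^sup>+s. ?L h s \<partial>lborel)"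
  proof (rule nn_integral_mono)
    fix s :: real
    show "ennreal a * ?L f s + ennreal b * ?L g s \<le> ?L h s"
    proof (cases "s \<in> {0..<1}")
      case True
      then have s1: "ennreal s < 1" by (simp add: ennreal_less_one_iff)
      have "{x. ennreal s < f x} \<noteq> {}" "{x. ennreal s < g x} \<noteq> {}"
        using s1 less_SUP_iff[of "ennreal s" f UNIV] less_SUP_iff[of "ennreal s" g UNIV] f g by auto
      then have "ennreal a * emeasure lborel {x. ennreal s < f x}
          + ennreal b * emeasure lborel {x. ennreal s < g x} \<le> emeasure lborel {x. ennreal s < h x}"
        using True h by (intro brunn_minkowski_real[OF ab]) auto
      then show ?thesis using True by simp
    qed simp
  qed
  also have "\<dots> = (\<integral>\<^sup>+x. min (h x) 1 \<partial>lborel)" by (simp add: layer_cake_min_1)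
  also have "\<dots> \<le> (\<integral>\<^sup>+x. h x \<partial>lborel)" by (intro nn_integral_mono) simp
  finally show ?thesis .
qed

text \<open>To avoid real powers of extended values, \<open>f(x)\<^sup>a g(y)\<^sup>b \<le> h(a x + b y)\<close> is expressed by
  quantifying over exponents \<open>u < log f(x)\<close> and \<open>v < log g(y)\<close>; this also covers the values
  \<open>0\<close> and \<open>\<infinity>\<close>, and the conclusion on the integrals has the same shape as the hypothesis.\<close>

lemma prekopa_leindler_real_bounded:
  fixes f g h :: "real \<Rightarrow> ennreal"
  assumes ab: "a > 0" "b > 0" "a + b = 1"
    and meas: "f \<in> borel_measurable borel" "g \<in> borel_measurable borel" "h \<in> borel_measurable borel"
    and bdd: "(SUP x. f x) \<noteq> \<infinity>" "(SUP x. g x) \<noteq> \<infinity>"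
    and h: "\<And>x y u v. ennreal (exp u) < f x \<Longrightarrow> ennreal (exp v) < g y \<Longrightarrow>
      ennreal (exp (a * u + b * v)) \<le> h (a * x + b * y)"
    and u: "ennreal (exp u) < (\<integral>\<^sup>+x. f x \<partial>lborel)"
    and v: "ennreal (exp v) < (\<integral>\<^sup>+x. g x \<partial>lborel)"
  shows "ennreal (exp (a * u + b * v)) \<le> (\<integral>\<^sup>+x. h x \<partial>lborel)"
proof -
  \<comment> \<open>A zero supremum would make the integral zero, against the strict lower bound
    \<open>exp u\<close>. Being positive and finite, the supremum has a logarithm.\<close>
  have log_SUP: "\<exists>m. (SUP x. f x) = ennreal (exp m)"
    if "(SUP x. f x) \<noteq> \<infinity>" "ennreal (exp u) < (\<integral>\<^sup>+x. f x \<partial>lborel)" for f :: "real \<Rightarrow> ennreal" and u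
  proof -
    have "(SUP x. f x) \<noteq> 0"
    proof
      assume "(SUP x. f x) = 0"
      then have "f x = 0" for x by (metis SUP_upper UNIV_I le_zero_eq)
      then show False using that by simp
    qed
    moreover have "\<exists>m. S = ennreal (exp m)" if "S \<noteq> 0" "S \<noteq> \<infinity>" for S
    proof (cases S)
      case (real r)
      with that show ?thesis by (intro exI[of _ "ln r"]) auto
    qed (use that in simp)
    ultimately show ?thesis using that(1) by blast
  qed
  obtain m where m: "(SUP x. f x) = ennreal (exp m)" using log_SUP bdd u by blast
  obtain n where n: "(SUP x. g x) = ennreal (exp n)" using log_SUP bdd v by blast
  let ?e = "\<lambda>c. ennreal (exp (- c))"
  \<comment> \<open>Dividing \<open>f\<close> by \<open>exp m\<close> and \<open>g\<close> by
    \<open>exp n\<close> forces division of \<open>h\<close> by the weighted geometric mean of these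
    factors, which is \<open>exp k\<close>.\<close>
  define k where "k = a * m + b * n"
  have unscale: "ennreal (s * exp c) < y" if "s \<ge> 0" "ennreal s < ?e c * y" for s c y
  proof -
    have "ennreal (exp c) * ennreal s < ennreal (exp c) * (?e c * y)"
      using that by (intro ennreal_mult_strict_left_mono) auto
    also have "ennreal (exp c) * (?e c * y) = y"
      by (simp add: mult.assoc[symmetric] ennreal_mult[symmetric] exp_minus_inverse)
    also have "ennreal (exp c) * ennreal s = ennreal (s * exp c)"
      using that by (simp add: ennreal_mult mult.commute)
    finally show ?thesis .
  qed
  have e1: "?e c * ennreal (exp c) = 1" for c
    by (simp add: ennreal_mult[symmetric] exp_add[symmetric])
  have "ennreal a * (\<integral>\<^sup>+x. ?e m * f x \<partial>lborel) + ennreal b * (\<integral>\<^sup>+x. ?e n * g x \<partial>lborel)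
      \<le> (\<integral>\<^sup>+x. ?e k * h x \<partial>lborel)"
  proof (rule prekopa_leindler_normalized[OF ab(1,2)])
    show "(SUP x. ?e m * f x) = 1" "(SUP x. ?e n * g x) = 1"
      using e1[of m] e1[of n] by (simp_all add: SUP_mult_left_ennreal[symmetric] m n)
    fix s x y assume s: "0 \<le> s" "ennreal s < ?e m * f x" "ennreal s < ?e n * g y"
    \<comment> \<open>The hypothesis on \<open>h\<close> gives only a weak inequality, so a level
      strictly above \<open>s\<close> is used to keep strictness. It is also positive, so its
      logarithm makes sense even for \<open>s = 0\<close>.\<close>
    obtain t where t: "ennreal s < t" "t < min (?e m * f x) (?e n * g y)"
      using dense[of "ennreal s" "min (?e m * f x) (?e n * g y)"] s by auto
    obtain r where r: "t = ennreal r" "r \<ge> 0" using t by (cases t) auto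
    then have r0: "s < r" "r > 0" using t s by (auto simp: ennreal_less_iff)
    have "ennreal (exp (ln r + m)) < f x" "ennreal (exp (ln r + n)) < g y"
      using t r r0 unscale[of r m "f x"] unscale[of r n "g y"] by (simp_all add: exp_add)
    then have "ennreal (exp (a * (ln r + m) + b * (ln r + n))) \<le> h (a * x + b * y)" by (rule h)
    also have "a * (ln r + m) + b * (ln r + n) = (a + b) * ln r + k"
      by (simp add: k_def algebra_simps)
    also have "exp \<dots> = r * exp k" using ab r0 by (simp add: exp_add)
    finally have "?e k * ennreal (r * exp k) \<le> ?e k * h (a * x + b * y)"
      by (rule mult_left_mono) simp
    also have "?e k * ennreal (r * exp k) = ennreal r"
      using r0 by (simp add: ennreal_mult[symmetric] exp_minus field_simps)
    finally show "ennreal s < ?e k * h (a * x + b * y)"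
      using r0 by (meson ennreal_lessI order_less_le_trans)
  qed (use meas in auto)
  then have le: "ennreal a * (?e m * (\<integral>\<^sup>+x. f x \<partial>lborel)) + ennreal b * (?e n * (\<integral>\<^sup>+x. g x \<partial>lborel))
      \<le> ?e k * (\<integral>\<^sup>+x. h x \<partial>lborel)"
    using meas by (simp add: nn_integral_cmult)
  \<comment> \<open>Weighted AM-GM, as convexity of \<open>exp\<close>, turns the arithmetic-mean
    bound into the geometric one; multiplying by \<open>exp k\<close> then undoes the
    normalization.\<close>
  have "exp (a * (u - m) + b * (v - n)) \<le> a * exp (u - m) + b * exp (v - n)"
    using exp_convex ab unfolding convex_on_def by auto
  then have "ennreal (exp (a * (u - m) + b * (v - n))) \<le> ennreal (a * exp (u - m) + b * exp (v - n))"
    by (rule ennreal_leI)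
  also have "\<dots> = ennreal a * (?e m * ennreal (exp u)) + ennreal b * (?e n * ennreal (exp v))"
    using ab by (simp add: ennreal_mult[symmetric] ennreal_plus[symmetric] exp_add[symmetric] del: ennreal_plus)
  also have "\<dots> \<le> ennreal a * (?e m * (\<integral>\<^sup>+x. f x \<partial>lborel)) + ennreal b * (?e n * (\<integral>\<^sup>+x. g x \<partial>lborel))"
    using u v by (intro add_mono mult_left_mono) auto
  also note le
  finally have "ennreal (exp k) * ennreal (exp (a * (u - m) + b * (v - n)))
      \<le> ennreal (exp k) * (?e k * (\<integral>\<^sup>+x. h x \<partial>lborel))"
    by (rule mult_left_mono) simp
  also have "\<dots> = (\<integral>\<^sup>+x. h x \<partial>lborel)"
    by (simp add: mult.assoc[symmetric] ennreal_mult[symmetric] exp_add[symmetric])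
  also have "ennreal (exp k) * ennreal (exp (a * (u - m) + b * (v - n))) = ennreal (exp (a * u + b * v))"
    by (simp add: ennreal_mult[symmetric] exp_add[symmetric] k_def algebra_simps)
  finally show ?thesis .
qed

lemma nn_integral_eq_SUP_truncation:
  fixes f :: "'a \<Rightarrow> ennreal"
  assumes [measurable]: "f \<in> borel_measurable M"
  shows "(\<integral>\<^sup>+x. f x \<partial>M) = (SUP k::nat. \<integral>\<^sup>+x. min (f x) (of_nat k) \<partial>M)"
proof -
  have "f x = (SUP k::nat. min (f x) (of_nat k))" for x
    by (simp add: min_def inf_min[symmetric] inf_SUP[symmetric] ennreal_SUP_of_nat_eq_top)
  then have "(\<integral>\<^sup>+x. f x \<partial>M) = (\<integral>\<^sup>+x. (SUP k::nat. min (f x) (of_nat k)) \<partial>M)" by simp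
  also have "\<dots> = (SUP k::nat. \<integral>\<^sup>+x. min (f x) (of_nat k) \<partial>M)"
    by (intro nn_integral_monotone_convergence_SUP)
       (auto simp: incseq_def le_fun_def intro: min.coboundedI2)
  finally show ?thesis .
qed

text \<open>Truncating \<open>f\<close> and \<open>g\<close> at a large enough height keeps the
  strict bounds on their integrals, by monotone convergence. Truncation only lowers \<open>f\<close>
  and \<open>g\<close>, so the hypothesis on \<open>h\<close> survives.\<close>

lemma prekopa_leindler_real:
  fixes f g h :: "real \<Rightarrow> ennreal"
  assumes ab: "a > 0" "b > 0" "a + b = 1"
    and meas[measurable]: "f \<in> borel_measurable borel" "g \<in> borel_measurable borel"
      "h \<in> borel_measurable borel"
    and h: "\<And>x y u v. ennreal (exp u) < f x \<Longrightarrow> ennreal (exp v) < g y \<Longrightarrow>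
      ennreal (exp (a * u + b * v)) \<le> h (a * x + b * y)"
    and u: "ennreal (exp u) < (\<integral>\<^sup>+x. f x \<partial>lborel)"
    and v: "ennreal (exp v) < (\<integral>\<^sup>+x. g x \<partial>lborel)"
  shows "ennreal (exp (a * u + b * v)) \<le> (\<integral>\<^sup>+x. h x \<partial>lborel)"
proof -
  obtain k :: nat where k: "ennreal (exp u) < (\<integral>\<^sup>+x. min (f x) (of_nat k) \<partial>lborel)"
    using u nn_integral_eq_SUP_truncation[of f lborel] by (auto simp: less_SUP_iff)
  obtain l :: nat where l: "ennreal (exp v) < (\<integral>\<^sup>+x. min (g x) (of_nat l) \<partial>lborel)"
    using v nn_integral_eq_SUP_truncation[of g lborel] by (auto simp: less_SUP_iff)
  have bdd: "(SUP x. min (f x) (of_nat k)) \<noteq> \<infinity>" for f :: "real \<Rightarrow> ennreal" and k :: nat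
  proof -
    have "(SUP x. min (f x) (of_nat k)) \<le> of_nat k" by (rule SUP_least) simp
    then show ?thesis by (metis ennreal_of_nat_neq_top infinity_ennreal_def top.extremum_unique)
  qed
  show ?thesis
    by (rule prekopa_leindler_real_bounded[OF ab _ _ meas(3) bdd bdd _ k l]) (auto intro: h)
qed

section \<open>The Prekopa-Leindler inequality in higher dimension\<close>

text \<open>Induction on the coordinates. The induction hypothesis for the slices at
  \<open>s\<close>, \<open>t\<close> and \<open>a * s + b * t\<close> is exactly the pointwise
  hypothesis that the one-dimensional inequality needs for the marginals.\<close>

lemma prekopa_leindler_PiM:
  fixes f g h :: "('i \<Rightarrow> real) \<Rightarrow> ennreal"
  assumes "finite I" and ab: "a > 0" "b > 0" "a + b = 1"
    and "f \<in> borel_measurable (PiM I (\<lambda>_. lborel))" "g \<in> borel_measurable (PiM I (\<lambda>_. lborel))"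
      "h \<in> borel_measurable (PiM I (\<lambda>_. lborel))"
    and "\<And>x y u v. ennreal (exp u) < f x \<Longrightarrow> ennreal (exp v) < g y \<Longrightarrow>
      ennreal (exp (a * u + b * v)) \<le> h (\<lambda>i. a * x i + b * y i)"
    and "ennreal (exp u) < (\<integral>\<^sup>+x. f x \<partial>PiM I (\<lambda>_. lborel))"
    and "ennreal (exp v) < (\<integral>\<^sup>+x. g x \<partial>PiM I (\<lambda>_. lborel))"
  shows "ennreal (exp (a * u + b * v)) \<le> (\<integral>\<^sup>+x. h x \<partial>PiM I (\<lambda>_. lborel))"
  using assms(1,5-)
proof (induction I arbitrary: f g h u v rule: finite_induct)
  case empty
  interpret product_sigma_finite "\<lambda>_::'i. lborel :: real measure" ..
  \<comment> \<open>The empty product is a single point, the function that is constantly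
    \<open>undefined\<close>; it is its own convex combination because
    \<open>a + b = 1\<close>.\<close>
  have "(\<lambda>i::'i. a * undefined + b * undefined) = (\<lambda>_. undefined :: real)"
    using ab by (simp add: distrib_right[symmetric])
  then show ?case
    using empty.prems(4)[of u "\<lambda>_. undefined" v "\<lambda>_. undefined"] empty.prems
    by (simp add: nn_integral_empty)
next
  case (insert i I)
  interpret product_sigma_finite "\<lambda>_::'i. lborel :: real measure" ..
  have slice: "(\<lambda>x. f (x(i := s))) \<in> borel_measurable (PiM I (\<lambda>_. lborel))"
    if [measurable]: "f \<in> borel_measurable (PiM (insert i I) (\<lambda>_. lborel))"
    for f :: "('i \<Rightarrow> real) \<Rightarrow> ennreal" and s :: real
    by measurable
  have marginal: "(\<lambda>s. \<integral>\<^sup>+x. f (x(i := s)) \<partial>PiM I (\<lambda>_. lborel)) \<in> borel_measurable borel"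
    if [measurable]: "f \<in> borel_measurable (PiM (insert i I) (\<lambda>_. lborel))"
    for f :: "('i \<Rightarrow> real) \<Rightarrow> ennreal"
  proof -
    interpret sigma_finite_measure "PiM I (\<lambda>_. lborel) :: ('i \<Rightarrow> real) measure"
      by (rule sigma_finite) fact
    have "(\<lambda>s. \<integral>\<^sup>+x. f (x(i := s)) \<partial>PiM I (\<lambda>_. lborel)) \<in> borel_measurable lborel"
      by measurable
    then show ?thesis by simp
  qed
  have int: "(\<integral>\<^sup>+x. f x \<partial>PiM (insert i I) (\<lambda>_. lborel))
      = (\<integral>\<^sup>+s. (\<integral>\<^sup>+x. f (x(i := s)) \<partial>PiM I (\<lambda>_. lborel)) \<partial>lborel)"
    if "f \<in> borel_measurable (PiM (insert i I) (\<lambda>_. lborel))" for f :: "('i \<Rightarrow> real) \<Rightarrow> ennreal"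
    by (rule product_nn_integral_insert_rev) (use insert that in auto)
  show ?case
    unfolding int[OF insert.prems(3)]
  proof (rule prekopa_leindler_real[OF ab _ _ _ _
        insert.prems(5)[unfolded int[OF insert.prems(1)]]
        insert.prems(6)[unfolded int[OF insert.prems(2)]]])
    fix s t u' v' :: real
    assume *: "ennreal (exp u') < (\<integral>\<^sup>+x. f (x(i := s)) \<partial>PiM I (\<lambda>_. lborel))"
      "ennreal (exp v') < (\<integral>\<^sup>+x. g (x(i := t)) \<partial>PiM I (\<lambda>_. lborel))"
    show "ennreal (exp (a * u' + b * v')) \<le> (\<integral>\<^sup>+x. h (x(i := a * s + b * t)) \<partial>PiM I (\<lambda>_. lborel))"
    proof (rule insert.IH[OF _ _ _ _ *])
      fix x y u v
      assume "ennreal (exp u) < f (x(i := s))" "ennreal (exp v) < g (y(i := t))"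
      then have "ennreal (exp (a * u + b * v)) \<le> h (\<lambda>j. a * (x(i := s)) j + b * (y(i := t)) j)"
        by (rule insert.prems(4))
      also have "(\<lambda>j. a * (x(i := s)) j + b * (y(i := t)) j)
          = (\<lambda>j. a * x j + b * y j)(i := a * s + b * t)" by auto
      finally show "ennreal (exp (a * u + b * v)) \<le> h ((\<lambda>j. a * x j + b * y j)(i := a * s + b * t))" .
    qed (intro slice insert.prems)+
  qed (intro marginal insert.prems)+
qed

text \<open>Lebesgue measure is the image of the product measure under the linear map
  \<open>?T\<close> that assembles a vector from its coordinates; linearity carries convex
  combinations across.\<close>

theorem prekopa_leindler:
  fixes f g h :: "'a::euclidean_space \<Rightarrow> ennreal"
  assumes ab: "a > 0" "b > 0" "a + b = 1"
    and meas: "f \<in> borel_measurable borel" "g \<in> borel_measurable borel" "h \<in> borel_measurable borel"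
    and h: "\<And>x y u v. ennreal (exp u) < f x \<Longrightarrow> ennreal (exp v) < g y \<Longrightarrow>
      ennreal (exp (a * u + b * v)) \<le> h (a *\<^sub>R x + b *\<^sub>R y)"
    and u: "ennreal (exp u) < (\<integral>\<^sup>+x. f x \<partial>lborel)"
    and v: "ennreal (exp v) < (\<integral>\<^sup>+x. g x \<partial>lborel)"
  shows "ennreal (exp (a * u + b * v)) \<le> (\<integral>\<^sup>+x. h x \<partial>lborel)"
proof -
  let ?P = "PiM Basis (\<lambda>_. lborel) :: ('a \<Rightarrow> real) measure"
  let ?T = "\<lambda>f. \<Sum>b\<in>Basis. f b *\<^sub>R (b::'a)"
  have T: "?T \<in> measurable ?P borel" by measurable
  have int: "(\<integral>\<^sup>+x. f x \<partial>lborel) = (\<integral>\<^sup>+x. f (?T x) \<partial>?P)"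
    if "f \<in> borel_measurable borel" for f :: "'a \<Rightarrow> ennreal"
    by (subst lborel_eq) (rule nn_integral_distr[OF T], use that in simp)
  have T_lin: "?T (\<lambda>i. a * x i + b * y i) = a *\<^sub>R ?T x + b *\<^sub>R ?T y" for x y
    by (simp add: scaleR_sum_right sum.distrib scaleR_add_left)
  show ?thesis
    unfolding int[OF meas(3)]
  proof (rule prekopa_leindler_PiM[OF finite_Basis ab])
    show "ennreal (exp (a * u + b * v)) \<le> h (?T (\<lambda>i. a * x i + b * y i))"
      if "ennreal (exp u) < f (?T x)" "ennreal (exp v) < g (?T y)" for x y u v
      unfolding T_lin using that by (rule h)
  qed (use meas T u v int in \<open>auto intro: measurable_compose\<close>)
qed

section \<open>Affine minorants and affine competitors\<close>

text \<open>A hyperplane separates the epigraph from the open vertical ray below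
  \<open>(x, \<psi> x)\<close>. It is not vertical, so it is the graph of the required affine
  function.\<close>

lemma convex_on_affine_minorant:
  fixes \<psi> :: "'a::euclidean_space \<Rightarrow> real"
  assumes "convex_on UNIV \<psi>"
  obtains \<xi> where "\<And>y. \<psi> x + \<xi> \<bullet> (y - x) \<le> \<psi> y"
proof -
  let ?S = "epigraph UNIV \<psi>" and ?T = "{x} \<times> {..<\<psi> x}"
  have "convex ?S" using assms by (rule convex_epigraphI)
  moreover have "convex ?T" by (intro convex_Times) auto
  moreover have "?S \<inter> ?T = {}" by (auto simp: mem_epigraph)
  moreover have "(x, \<psi> x) \<in> ?S" "(x, \<psi> x - 1) \<in> ?T" by (auto simp: mem_epigraph)
  ultimately obtain p c where p: "p \<noteq> 0" and le: "\<forall>z\<in>?S. p \<bullet> z \<le> c" and ge: "\<forall>z\<in>?T. p \<bullet> z \<ge> c"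
    using separating_hyperplane_sets[of ?S ?T] by blast
  obtain \<eta> d where pd: "p = (\<eta>, d)" by (cases p)
  have le': "\<eta> \<bullet> y + d * s \<le> c" if "\<psi> y \<le> s" for y s
    using bspec[OF le, of "(y, s)"] that by (simp add: mem_epigraph pd)
  have ge': "c \<le> \<eta> \<bullet> x + d * s" if "s < \<psi> x" for s
    using ge that by (auto simp: pd)
  \<comment> \<open>If \<open>d = 0\<close> the hyperplane is vertical. The epigraph lies over the
    whole space, so the point over \<open>x + \<eta>\<close> can be tested, which forces
    \<open>\<eta> = 0\<close> and hence \<open>p = 0\<close>.\<close>
  have "d < 0"
  proof (rule ccontr)
    assume "\<not> d < 0"
    moreover have "d \<le> 0"
      using le'[of x "\<psi> x"] ge'[of "\<psi> x - 1"] by (simp add: algebra_simps)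
    ultimately have "d = 0" by simp
    then have "\<eta> \<bullet> (x + \<eta>) \<le> \<eta> \<bullet> x"
      using le'[of "x + \<eta>" "\<psi> (x + \<eta>)"] ge'[of "\<psi> x - 1"] by simp
    then have "\<eta> \<bullet> \<eta> \<le> 0" by (simp only: inner_add_right)
    then have "\<eta> = 0" by (metis inner_gt_zero_iff not_le)
    with \<open>d = 0\<close> p pd show False by (simp add: zero_prod_def)
  qed
  \<comment> \<open>Letting the height on the ray tend to \<open>\<psi> x\<close> shows that the
    hyperplane touches the epigraph at \<open>(x, \<psi> x)\<close>.\<close>
  have "c \<le> \<eta> \<bullet> x + d * \<psi> x"
  proof (rule field_le_epsilon)
    fix e :: real assume "e > 0"
    with \<open>d < 0\<close> have "e / d < 0" by (simp add: divide_pos_neg)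
    then show "c \<le> \<eta> \<bullet> x + d * \<psi> x + e"
      using ge'[of "\<psi> x + e / d"] \<open>d < 0\<close> by (simp add: algebra_simps)
  qed
  then have *: "\<eta> \<bullet> (y - x) \<le> - d * (\<psi> y - \<psi> x)" for y
    using le'[of y "\<psi> y"] by (simp add: algebra_simps inner_diff_right)
  have "\<psi> x + (\<eta> /\<^sub>R - d) \<bullet> (y - x) \<le> \<psi> y" for y
    using *[of y] \<open>d < 0\<close> by (simp add: field_simps)
  then show thesis by (rule that)
qed

lemma convex_on_slice:
  assumes "convex_on UNIV \<phi>"
  shows "convex_on UNIV (\<lambda>y. \<phi> (t, y))"
proof (rule convex_onI)
  fix s :: real and x y assume "0 < s" "s < 1"
  then show "\<phi> (t, (1 - s) *\<^sub>R x + s *\<^sub>R y) \<le> (1 - s) * \<phi> (t, x) + s * \<phi> (t, y)"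
    using convex_onD[OF assms, of s "(t, x)" "(t, y)"]
    by (simp add: scaleR_left_distrib[symmetric])
qed simp

text \<open>An affine function of slope \<open>\<xi>\<close>, lowered by the logarithm of a number
  above the integral, is an admissible competitor, so its value at \<open>x\<close> is at most
  \<open>s\<close>. In exponential form the bound also covers an infinite integral.\<close>

lemma extremal_function_ge:
  fixes \<phi> :: "'a::euclidean_space \<Rightarrow> real"
  assumes "extremal_function \<phi> x \<le> ereal s"
    and meas: "(\<lambda>y. ennreal (exp (\<xi> \<bullet> y - \<phi> y))) \<in> borel_measurable borel"
  shows "ennreal (exp (\<xi> \<bullet> x - s)) \<le> (\<integral>\<^sup>+y. ennreal (exp (\<xi> \<bullet> y - \<phi> y)) \<partial>lborel)"
proof (rule ccontr)
  let ?I = "\<integral>\<^sup>+y. ennreal (exp (\<xi> \<bullet> y - \<phi> y)) \<partial>lborel"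
  assume "\<not> ?thesis"
  then have "?I < ennreal (exp (\<xi> \<bullet> x - s))" by simp
  \<comment> \<open>Strictly between the two sides lies a finite positive number, so
    \<open>ln r\<close> is meaningful and the competitor still exceeds \<open>s\<close> at
    \<open>x\<close>.\<close>
  then obtain q where q: "?I < q" "q < ennreal (exp (\<xi> \<bullet> x - s))" using dense by blast
  then obtain r where r: "q = ennreal r" "r \<ge> 0" by (cases q) auto
  then have r0: "r > 0" "r < exp (\<xi> \<bullet> x - s)"
    using q by (auto simp: ennreal_less_iff intro: ccontr)
  define \<psi> where "\<psi> = (\<lambda>y. \<xi> \<bullet> y - ln r)"
  have "convex_on UNIV \<psi>"
    by (rule convex_onI) (auto simp: \<psi>_def inner_add_right algebra_simps)
  moreover have "(\<integral>\<^sup>+y. ennreal (exp (\<psi> y - \<phi> y)) \<partial>lborel) \<le> 1"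
  proof -
    have "exp (\<psi> y - \<phi> y) = inverse r * exp (\<xi> \<bullet> y - \<phi> y)" for y
      using r0 by (simp add: \<psi>_def exp_diff exp_add field_simps)
    then have "(\<integral>\<^sup>+y. ennreal (exp (\<psi> y - \<phi> y)) \<partial>lborel) = ennreal (inverse r) * ?I"
      using r0 meas by (simp add: ennreal_mult nn_integral_cmult)
    also have "\<dots> \<le> ennreal (inverse r) * ennreal r"
      using q r by (intro mult_left_mono) auto
    also have "\<dots> = 1" using r0 by (simp add: ennreal_mult[symmetric])
    finally show ?thesis .
  qed
  ultimately have "ereal (\<psi> x) \<le> extremal_function \<phi> x"
    unfolding extremal_function_def by (intro Sup_upper) auto
  then have "\<psi> x \<le> s" using assms(1) by (metis ereal_less_eq(3) order_trans)
  moreover have "ln r < \<xi> \<bullet> x - s" using r0 by (metis exp_less_cancel_iff exp_ln)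
  ultimately show False by (simp add: \<psi>_def)
qed

section \<open>Joint convexity of the extremal function\<close>

theorem corollary3p1:
  fixes \<phi> :: "(real ^ 'm) \<times> (real ^ 'n) \<Rightarrow> real"
  assumes "convex_on UNIV \<phi>"
  shows "convex_ereal_fun (\<lambda>(t, x). extremal_function (\<lambda>y. \<phi> (t, y)) x)"
  unfolding convex_ereal_fun_def
proof (rule convexI, clarsimp)
  fix t0 t1 :: "real ^ 'm" and x0 x1 :: "real ^ 'n" and s0 s1 a b :: real
  assume E0: "extremal_function (\<lambda>y. \<phi> (t0, y)) x0 \<le> ereal s0"
    and E1: "extremal_function (\<lambda>y. \<phi> (t1, y)) x1 \<le> ereal s1"
    and "0 \<le> a" "0 \<le> b" and ab1: "a + b = 1"
  let ?t = "a *\<^sub>R t0 + b *\<^sub>R t1" and ?x = "a *\<^sub>R x0 + b *\<^sub>R x1" and ?s = "a * s0 + b * s1"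
  show "extremal_function (\<lambda>y. \<phi> (?t, y)) ?x \<le> ereal ?s"
  proof (cases "a = 0 \<or> b = 0")
    case True
    then show ?thesis using E0 E1 ab1 by auto
  next
    case False
    then have ab: "a > 0" "b > 0" "a + b = 1" using \<open>0 \<le> a\<close> \<open>0 \<le> b\<close> ab1 by auto
    let ?F = "\<lambda>\<xi> t y. ennreal (exp (\<xi> \<bullet> y - \<phi> (t, y)))"
    have meas: "?F \<xi> t \<in> borel_measurable borel" for \<xi> t
    proof -
      have "continuous_on UNIV (\<lambda>y. \<phi> (t, y))"
        by (rule convex_on_continuous[OF open_UNIV convex_on_slice[OF assms]])
      then have [measurable]: "(\<lambda>y. \<phi> (t, y)) \<in> borel_measurable borel"
        by (rule borel_measurable_continuous_onI)
      show ?thesis by measurable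
    qed
    have "\<psi> ?x \<le> ?s"
      if \<psi>: "convex_on UNIV \<psi>" and int: "(\<integral>\<^sup>+y. ennreal (exp (\<psi> y - \<phi> (?t, y))) \<partial>lborel) \<le> 1" for \<psi>
    proof (rule field_le_epsilon)
      fix e :: real assume "e > 0"
      \<comment> \<open>The slope of a competitor at the intermediate parameter \<open>?t\<close> is
        used as a common tilt at \<open>t0\<close>, \<open>t1\<close> and \<open>?t\<close>.\<close>
      obtain \<xi> where \<xi>: "\<And>y. \<psi> ?x + \<xi> \<bullet> (y - ?x) \<le> \<psi> y"
        using convex_on_affine_minorant[OF \<psi>] by blast
      \<comment> \<open>Logarithmic lower bounds for the tilted integrals at \<open>t0\<close> and
        \<open>t1\<close>, lowered by \<open>e\<close> because Prekopa-Leindler takes strict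
        ones.\<close>
      define u v where "u = \<xi> \<bullet> x0 - s0 - e" and "v = \<xi> \<bullet> x1 - s1 - e"
      have "ennreal (exp u) < ennreal (exp (\<xi> \<bullet> x0 - s0))" "ennreal (exp v) < ennreal (exp (\<xi> \<bullet> x1 - s1))"
        using \<open>e > 0\<close> by (auto simp: u_def v_def intro!: ennreal_lessI)
      then have uv: "ennreal (exp u) < (\<integral>\<^sup>+y. ?F \<xi> t0 y \<partial>lborel)"
          "ennreal (exp v) < (\<integral>\<^sup>+y. ?F \<xi> t1 y \<partial>lborel)"
        using extremal_function_ge[OF E0 meas] extremal_function_ge[OF E1 meas]
        by (auto intro: order_less_le_trans)
      have "ennreal (exp (a * u + b * v)) \<le> (\<integral>\<^sup>+y. ?F \<xi> ?t y \<partial>lborel)"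
      proof (rule prekopa_leindler[OF ab meas meas meas _ uv])
        fix y z u v
        assume "ennreal (exp u) < ?F \<xi> t0 y" "ennreal (exp v) < ?F \<xi> t1 z"
        then have "u \<le> \<xi> \<bullet> y - \<phi> (t0, y)" "v \<le> \<xi> \<bullet> z - \<phi> (t1, z)"
          by (auto simp: ennreal_less_iff)
        then have "a * u + b * v \<le> a * (\<xi> \<bullet> y - \<phi> (t0, y)) + b * (\<xi> \<bullet> z - \<phi> (t1, z))"
          using ab by (intro add_mono mult_left_mono) auto
        also have "\<dots> = \<xi> \<bullet> (a *\<^sub>R y + b *\<^sub>R z) - (a * \<phi> (t0, y) + b * \<phi> (t1, z))"
          by (simp add: inner_add_right algebra_simps)
        \<comment> \<open>Joint convexity of \<open>\<phi>\<close> enters here: \<open>t\<close> and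
          \<open>y\<close> move together along a segment.\<close>
        also have "\<dots> \<le> \<xi> \<bullet> (a *\<^sub>R y + b *\<^sub>R z) - \<phi> (?t, a *\<^sub>R y + b *\<^sub>R z)"
        proof -
          have "\<phi> (a *\<^sub>R (t0, y) + b *\<^sub>R (t1, z)) \<le> a * \<phi> (t0, y) + b * \<phi> (t1, z)"
            using assms ab unfolding convex_on_def by auto
          then show ?thesis by simp
        qed
        finally show "ennreal (exp (a * u + b * v)) \<le> ?F \<xi> ?t (a *\<^sub>R y + b *\<^sub>R z)"
          by (intro ennreal_leI) simp
      qed
      \<comment> \<open>The minorant bounds the tilt \<open>\<xi> \<bullet> y\<close> by
        \<open>\<psi> y\<close> plus a constant, so the constraint on \<open>\<psi>\<close> bounds
        the tilted integral at \<open>?t\<close> by the exponential of that constant.\<close>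
      also have "\<dots> \<le> (\<integral>\<^sup>+y. ennreal (exp (\<xi> \<bullet> ?x - \<psi> ?x)) * ennreal (exp (\<psi> y - \<phi> (?t, y))) \<partial>lborel)"
      proof (intro nn_integral_mono)
        fix y
        have "\<xi> \<bullet> y - \<phi> (?t, y) \<le> (\<xi> \<bullet> ?x - \<psi> ?x) + (\<psi> y - \<phi> (?t, y))"
          using \<xi>[of y] by (simp add: inner_diff_right)
        then show "?F \<xi> ?t y \<le> ennreal (exp (\<xi> \<bullet> ?x - \<psi> ?x)) * ennreal (exp (\<psi> y - \<phi> (?t, y)))"
          by (simp add: ennreal_mult[symmetric] exp_add[symmetric] ennreal_leI)
      qed
      also have "\<dots> = ennreal (exp (\<xi> \<bullet> ?x - \<psi> ?x)) * (\<integral>\<^sup>+y. ennreal (exp (\<psi> y - \<phi> (?t, y))) \<partial>lborel)"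
      proof (rule nn_integral_cmult)
        have "continuous_on UNIV \<psi>" "continuous_on UNIV (\<lambda>y. \<phi> (?t, y))"
          using convex_on_continuous[OF open_UNIV \<psi>]
            convex_on_continuous[OF open_UNIV convex_on_slice[OF assms]] by auto
        then have [measurable]: "\<psi> \<in> borel_measurable borel" "(\<lambda>y. \<phi> (?t, y)) \<in> borel_measurable borel"
          by (auto intro: borel_measurable_continuous_onI)
        show "(\<lambda>y. ennreal (exp (\<psi> y - \<phi> (?t, y)))) \<in> borel_measurable lborel" by measurable
      qed
      also have "\<dots> \<le> ennreal (exp (\<xi> \<bullet> ?x - \<psi> ?x)) * 1"
        using int by (intro mult_left_mono) auto
      finally have "a * u + b * v \<le> \<xi> \<bullet> ?x - \<psi> ?x" by simp
      \<comment> \<open>Comparing exponents cancels \<open>\<xi> \<bullet> ?x\<close> and leaves an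
        error of exactly \<open>e\<close>, since \<open>a + b = 1\<close>.\<close>
      moreover have "a * u + b * v = \<xi> \<bullet> ?x - ?s - (a + b) * e"
        by (simp add: u_def v_def inner_add_right algebra_simps)
      ultimately show "\<psi> ?x \<le> ?s + e" using ab by simp
    qed
    then show ?thesis
      unfolding extremal_function_def by (intro Sup_least) auto
  qed
qed

end
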